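(* Let $E$ be a Hilbert space and let $\tau$ be a Hausdorff topology on $E$. Let $\{ T(t) : t \geq 0 \}$ be a one-parameter $\tau$-continuous semigroup of nonexpansive mappings on a bounded closed convex subset $C$ of $E$. Fix $\alpha, \beta > 0$ with $\alpha / \beta \notin \mathbb{Q}$. Let $x \in C$ and define a sequence $\{ x_n \}$ in $C$ by $$ x_{n} = \frac{1}{n} \sum_{k=1}^n \left( \frac{T(\alpha)+T(\beta)}{2} \right)^k x $$ for $n \in \mathbb{N}$, where $\left( \frac{T(\alpha)+T(\beta)}{2} \right)^k$ is the $k$-fold iterate of the mapping $y \mapsto \frac{1}{2}\big(T(\alpha)y + T(\beta)y\big)$ on $C$. Then $\{ x_n \}$ converges weakly to a common fixed point of $\{ T(t) : t \geq 0 \}$.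
   Context: $\mathbb{N}$ is the set of positive integers and $\mathbb{Q}$ the set of rational numbers. Let $C$ be a subset of a Banach space $E$ and let $\tau$ be a Hausdorff topology on $E$ (not necessarily the norm topology). A family $\{T(t) : t \geq 0\}$ of mappings from $C$ into $C$ is called a one-parameter $\tau$-continuous semigroup of nonexpansive mappings on $C$ if: (sg 1) $T(s+t) = T(s) \circ T(t)$ for all $s, t \geq 0$; (sg 2) for each $x \in C$, the mapping $t \mapsto T(t)x$ from $[0,\infty)$ into $C$ is continuous with respect to $\tau$; (sg 3) for each $t \geq 0$, $T(t)$ is nonexpansive, i.e., $\|T(t)x - T(t)y\| \leq \|x-y\|$ for all $x,y \in C$. (It is not required that $T(0)$ be the identity mapping.) A common fixed point of $\{T(t) : t \geq 0\}$ is a point $z \in C$ with $T(t)z = z$ for all $t \geq 0$. *)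

theory Defs
  imports "HOL-Analysis.Analysis"
begin

definition weakly_converges :: "(nat \<Rightarrow> 'a::real_normed_vector) \<Rightarrow> 'a \<Rightarrow> bool"
  where "weakly_converges u l \<longleftrightarrow>
    (\<forall>f :: 'a \<Rightarrow> real. bounded_linear f \<longrightarrow> (\<lambda>n. f (u n)) \<longlonglongrightarrow> f l)"

definition nonexpansive_on :: "'a::real_normed_vector set \<Rightarrow> ('a \<Rightarrow> 'a) \<Rightarrow> bool"
  where "nonexpansive_on C S \<longleftrightarrow> (\<forall>x\<in>C. \<forall>y\<in>C. norm (S x - S y) \<le> norm (x - y))"

text \<open>Only the values \<open>T t x\<close> with \<open>t \<ge> 0\<close> and \<open>x \<in> C\<close> matter. The map \<open>T 0\<close> is not
  required to be the identity on \<open>C\<close>.\<close>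

definition nonexpansive_semigroup ::
  "'a::real_normed_vector topology \<Rightarrow> 'a set \<Rightarrow> (real \<Rightarrow> 'a \<Rightarrow> 'a) \<Rightarrow> bool"
  where "nonexpansive_semigroup \<tau> C T \<longleftrightarrow>
    (\<forall>t\<ge>0. T t \<in> C \<rightarrow> C) \<and>
    (\<forall>s\<ge>0. \<forall>t\<ge>0. \<forall>x\<in>C. T (s + t) x = T s (T t x)) \<and>
    (\<forall>x\<in>C. continuous_map (top_of_set {0..}) (subtopology \<tau> C) (\<lambda>t. T t x)) \<and>
    (\<forall>t\<ge>0. nonexpansive_on C (T t))"

definition common_fixed_point :: "'a set \<Rightarrow> (real \<Rightarrow> 'a \<Rightarrow> 'a) \<Rightarrow> 'a \<Rightarrow> bool"
  where "common_fixed_point C T z \<longleftrightarrow> z \<in> C \<and> (\<forall>t\<ge>0. T t z = z)"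

end

theory Submission
  imports Defs
begin

text \<open>
  The proof combines Baillon's nonlinear mean ergodic theorem with a density argument. For a
  nonexpansive \<open>S\<close> on \<open>C\<close>, a point \<open>w \<in> C\<close> is fixed iff
  \<open>2 \<langle>w - y, y - S y\<rangle> + \<parallel>y - S y\<parallel>\<^sup>2 \<le> 0\<close> for all \<open>y \<in> C\<close>. These conditions are
  affine in \<open>w\<close>, so the fixed points form a closed convex set, and they pass to weak limits of
  averaged orbits, so weak cluster points of the orbit means are fixed. Two such cluster points
  coincide because \<open>\<parallel>S\<^sup>k x - w\<parallel>\<close> decreases in \<open>k\<close> for every fixed point \<open>w\<close>.

  The commuting maps \<open>T \<alpha>\<close> and \<open>T \<beta>\<close> therefore have a common fixed point, and then every fixed
  point of their average is fixed by both. The times fixing such a point are closed under addition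
  and absolute difference, hence dense by Dirichlet approximation of \<open>\<alpha> / \<beta>\<close>, and they form a
  closed set since \<open>\<tau>\<close> is Hausdorff.
\<close>

section \<open>Hilbert space tools: minimisation, Riesz representation, weak compactness\<close>

text \<open>The point \<open>p\<close> minimises \<open>\<parallel>y\<parallel>\<^sup>2 / 2 - f y\<close> over \<open>K\<close>. Taking \<open>K = UNIV\<close> gives the Riesz
  representation of \<open>f\<close>, and taking \<open>f = \<langle>w, \<cdot>\<rangle>\<close> gives the projection of \<open>w\<close> onto \<open>K\<close>.\<close>

lemma variational_inequality:
  fixes f :: "'a::{real_inner, complete_space} \<Rightarrow> real"
  assumes "bounded_linear f" and "closed K" and "convex K" and "K \<noteq> {}"
  obtains p where "p \<in> K" and "\<And>c. c \<in> K \<Longrightarrow> f (c - p) \<le> p \<bullet> (c - p)"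
proof -
  interpret f: bounded_linear f by fact
  define J where "J y = (norm y)\<^sup>2 / 2 - f y" for y
  obtain M where M: "\<And>y. \<bar>f y\<bar> \<le> norm y * M"
    using f.bounded by auto
  have lower: "- M\<^sup>2 / 2 \<le> J y" for y
  proof -
    have "0 \<le> (norm y - M)\<^sup>2" by simp
    then show ?thesis
      using M[of y] unfolding J_def power2_diff by (simp add: field_simps)
  qed
  have bdd: "bdd_below (J ` K)"
    using lower by (auto intro!: bdd_belowI2)
  define m where "m = (INF y\<in>K. J y)"
  have m_le: "m \<le> J y" if "y \<in> K" for y
    unfolding m_def using bdd that by (rule cINF_lower)
  have "\<exists>y\<in>K. J y < m + 1 / Suc n" for n
    using cINF_less_iff[OF \<open>K \<noteq> {}\<close> bdd, of "m + 1 / Suc n"] by (simp add: m_def)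
  then obtain y where y: "\<And>n. y n \<in> K" "\<And>n. J (y n) < m + 1 / Suc n"
    by metis
  \<comment> \<open>Parallelogram law: the linear part \<open>f\<close> cancels. Near-minimisers
    whose midpoint also lies in \<open>K\<close> are therefore close together, and minimising
    sequences are Cauchy.\<close>
  have J_mid: "(norm (a - b))\<^sup>2 / 8 = (J a + J b) / 2 - J ((1/2) *\<^sub>R a + (1/2) *\<^sub>R b)" for a b
    unfolding J_def f.add f.scaleR power2_norm_eq_inner
    by (simp add: inner_simps inner_commute[of b a] field_simps)
  have mid: "(1/2) *\<^sub>R a + (1/2) *\<^sub>R b \<in> K" if "a \<in> K" "b \<in> K" for a b
    using convexD[OF \<open>convex K\<close> that, of "1/2" "1/2"] by simp
  have dist_y: "(dist (y k) (y l))\<^sup>2 < 8 / Suc n" if "k \<ge> n" "l \<ge> n" for k l n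
  proof -
    define e where "e = 1 / Suc n"
    have "1 / Suc k \<le> e" "1 / Suc l \<le> e"
      using that by (auto simp: e_def field_simps)
    then have "J (y k) < m + e" "J (y l) < m + e"
      using y(2)[of k] y(2)[of l] by linarith+
    moreover have "m \<le> J ((1/2) *\<^sub>R y k + (1/2) *\<^sub>R y l)"
      by (intro m_le mid y)
    ultimately have "(norm (y k - y l))\<^sup>2 / 8 < e"
      unfolding J_mid by (simp add: field_simps)
    then show ?thesis by (simp add: e_def dist_norm)
  qed
  have "Cauchy y"
  proof (rule metric_CauchyI)
    fix e :: real assume "e > 0"
    then obtain n where "inverse (real (Suc n)) < e\<^sup>2 / 8"
      using reals_Archimedean[of "e\<^sup>2 / 8"] by auto
    then have "8 / real (Suc n) < e\<^sup>2" by (simp add: inverse_eq_divide)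
    then show "\<exists>N. \<forall>k\<ge>N. \<forall>l\<ge>N. dist (y k) (y l) < e"
      using dist_y \<open>e > 0\<close> by (meson less_le_not_le less_trans power2_less_imp_less)
  qed
  then obtain p where p: "y \<longlonglongrightarrow> p"
    using Cauchy_convergent convergentD by blast
  have "p \<in> K"
    using closed_sequentially[OF \<open>closed K\<close>] y(1) p by blast
  have "(\<lambda>n. J (y n)) \<longlonglongrightarrow> J p"
    unfolding J_def by (intro tendsto_intros f.tendsto p) simp
  moreover have "(\<lambda>n. m + 1 / real (Suc n)) \<longlonglongrightarrow> m + 0"
    using LIMSEQ_inverse_real_of_nat by (intro tendsto_add) (auto simp: inverse_eq_divide)
  ultimately have Jp: "J p \<le> m"
    using y(2) by (intro LIMSEQ_le[of _ "J p" _ m]) (auto intro: less_imp_le)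
  have "f (c - p) \<le> p \<bullet> (c - p)" if "c \<in> K" for c
  proof (rule ccontr)
    assume neg: "\<not> f (c - p) \<le> p \<bullet> (c - p)"
    define d where "d = f (c - p) - p \<bullet> (c - p)"
    have "d > 0" using neg by (simp add: d_def)
    \<comment> \<open>First-order optimality: \<open>J p\<close> is compared with \<open>J\<close>
      on the segment from \<open>p\<close> towards \<open>c\<close>. After division by
      \<open>t\<close>, letting \<open>t\<close> tend to 0 from the right contradicts
      \<open>d > 0\<close>.\<close>
    have ineq: "d \<le> t * (norm (c - p))\<^sup>2 / 2" if t: "0 < t" "t \<le> 1" for t
    proof -
      have "(1 - t) *\<^sub>R p + t *\<^sub>R c \<in> K"
        using convexD[OF \<open>convex K\<close> \<open>p \<in> K\<close> \<open>c \<in> K\<close>, of "1 - t" t] t by simp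
      then have "p + t *\<^sub>R (c - p) \<in> K" by (simp add: algebra_simps)
      from m_le[OF this] Jp have "J p \<le> J (p + t *\<^sub>R (c - p))" by simp
      also have "\<dots> = J p + t * (t * (norm (c - p))\<^sup>2 / 2 - d)"
      proof -
        have "(norm (p + t *\<^sub>R (c - p)))\<^sup>2
            = (norm p)\<^sup>2 + 2 * t * (p \<bullet> (c - p)) + t\<^sup>2 * (norm (c - p))\<^sup>2"
          unfolding power2_norm_eq_inner
          by (simp add: inner_add_left inner_add_right inner_commute[of "c - p" p] power2_eq_square
              distrib_left del: inner_diff_left inner_diff_right)
        then show ?thesis
          unfolding J_def d_def f.add f.scaleR by (simp add: power2_eq_square field_simps)
      qed
      finally show ?thesis using t by (simp add: zero_le_mult_iff)
    qed
    have "(\<lambda>t. t * (norm (c - p))\<^sup>2 / 2) \<midarrow>0\<rightarrow> 0 * (norm (c - p))\<^sup>2 / 2"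
      by (intro tendsto_intros) auto
    then have "((\<lambda>t. t * (norm (c - p))\<^sup>2 / 2) \<longlongrightarrow> 0) (at_right 0)"
      by (simp add: filterlim_at_split)
    moreover have "\<forall>\<^sub>F t in at_right 0. d \<le> t * (norm (c - p))\<^sup>2 / 2"
    proof (rule eventually_at_rightI)
      fix t :: real assume "t \<in> {0<..<1}"
      then show "d \<le> t * (norm (c - p))\<^sup>2 / 2" by (intro ineq) auto
    qed simp
    ultimately have "d \<le> 0"
      by (intro tendsto_lowerbound) auto
    then show False using \<open>d > 0\<close> by simp
  qed
  then show ?thesis using that \<open>p \<in> K\<close> by blast
qed

lemma Riesz_representation:
  fixes f :: "'a::{real_inner, complete_space} \<Rightarrow> real"
  assumes "bounded_linear f"
  obtains p where "\<And>y. f y = p \<bullet> y"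
proof -
  interpret f: bounded_linear f by fact
  obtain p where p: "\<And>c. f (c - p) \<le> p \<bullet> (c - p)"
    using variational_inequality[OF assms, of UNIV] by auto
  \<comment> \<open>Without a constraint, testing with both \<open>p + y\<close> and
    \<open>p - y\<close> turns the inequality into an equality.\<close>
  have "f y = p \<bullet> y" for y
    using p[of "p + y"] p[of "p - y"] by (simp add: f.neg f.diff inner_diff_right)
  then show ?thesis using that by blast
qed

text \<open>Weak compactness comes from Tychonoff's theorem in \<open>'a \<Rightarrow> real\<close>. Since the weak topology need
  not be metrizable, refinements of filters take the place of subsequences.\<close>

lemma weak_cluster_point:
  fixes u :: "'i \<Rightarrow> 'a::{real_inner, complete_space}"
  assumes "F \<noteq> bot" and C: "bounded C" "closed C" "convex C"
    and u: "\<forall>\<^sub>F i in F. u i \<in> C"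
  obtains G w where "G \<noteq> bot" and "G \<le> F" and "w \<in> C"
    and "\<And>y. ((\<lambda>i. u i \<bullet> y) \<longlongrightarrow> w \<bullet> y) G"
proof -
  define \<Phi> where "\<Phi> i = (\<lambda>y. u i \<bullet> y)" for i
  obtain B where B: "\<And>c. c \<in> C \<Longrightarrow> norm c \<le> B"
    using \<open>bounded C\<close> bounded_iff by blast
  \<comment> \<open>A product of compact intervals which, by Cauchy-Schwarz, contains the functional
    of every point of \<open>C\<close>.\<close>
  define K :: "('a \<Rightarrow> real) set" where "K = PiE UNIV (\<lambda>y. cball 0 (norm y * B))"
  have "compact K"
    unfolding K_def compactin_euclidean_iff[symmetric] euclidean_product_topology[symmetric]
    by (simp add: compactin_PiE)
  moreover have "\<forall>\<^sub>F g in filtermap \<Phi> F. g \<in> K"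
    unfolding eventually_filtermap using u
  proof eventually_elim
    case (elim i)
    have "\<bar>u i \<bullet> y\<bar> \<le> norm y * B" for y
      using Cauchy_Schwarz_ineq2[of "u i" y] mult_left_mono[OF B[OF elim], of "norm y"]
      by (simp add: mult.commute)
    then show ?case by (auto simp: K_def \<Phi>_def PiE_iff)
  qed
  ultimately obtain L where "L \<in> K" and L: "inf (nhds L) (filtermap \<Phi> F) \<noteq> bot"
    using \<open>F \<noteq> bot\<close> unfolding compact_filter by (metis filtermap_bot_iff)
  \<comment> \<open>\<open>L\<close> is only a cluster point of the functionals; refining
    \<open>F\<close> by the preimages of the neighbourhoods of \<open>L\<close> makes them converge
    to \<open>L\<close>.\<close>
  define G where "G = inf F (filtercomap \<Phi> (nhds L))"
  have "G \<noteq> bot"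
  proof
    assume "G = bot"
    then have "eventually (\<lambda>_. False) G" by simp
    then obtain P Q where PQ: "eventually P F" "eventually Q (nhds L)" "\<And>i. P i \<Longrightarrow> Q (\<Phi> i) \<Longrightarrow> False"
      unfolding G_def eventually_inf eventually_filtercomap by metis
    then have "eventually (\<lambda>g. \<not> Q g) (filtermap \<Phi> F)"
      unfolding eventually_filtermap using PQ(3) by (auto elim!: eventually_mono)
    then have "eventually (\<lambda>_. False) (inf (nhds L) (filtermap \<Phi> F))"
      unfolding eventually_inf using PQ(2) by blast
    then show False using L by (simp add: trivial_limit_def)
  qed
  have "G \<le> F" by (simp add: G_def)
  have "filterlim \<Phi> (nhds L) G"
    unfolding filterlim_iff_le_filtercomap G_def by simp
  have lim: "((\<lambda>i. u i \<bullet> y) \<longlongrightarrow> L y) G" for y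
  proof -
    have "continuous_on UNIV (\<lambda>g :: 'a \<Rightarrow> real. g y)"
      by (rule continuous_on_product_coordinates)
    then have "((\<lambda>g. g y) \<longlongrightarrow> L y) (nhds L)"
      by (simp add: continuous_on_def tendsto_def eventually_nhds_conv_at)
    from filterlim_compose[OF this \<open>filterlim \<Phi> (nhds L) G\<close>] show ?thesis
      by (simp add: \<Phi>_def)
  qed
  have "bounded_linear L"
  proof (rule bounded_linear_intro)
    fix y z and r :: real
    show "L (y + z) = L y + L z"
      using tendsto_unique[OF \<open>G \<noteq> bot\<close> lim] tendsto_add[OF lim lim]
      by (simp add: inner_add_right)
    show "L (r *\<^sub>R y) = r *\<^sub>R L y"
      using tendsto_unique[OF \<open>G \<noteq> bot\<close> lim] tendsto_mult_left[OF lim]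
      by simp
    show "norm (L y) \<le> norm y * B"
      using \<open>L \<in> K\<close> by (auto simp: K_def PiE_iff)
  qed
  then obtain w where w: "\<And>y. L y = w \<bullet> y"
    by (rule Riesz_representation) blast
  have "\<exists>c. c \<in> C"
    using u \<open>F \<noteq> bot\<close> eventually_happens by blast
  \<comment> \<open>Weak closedness of \<open>C\<close>: \<open>p\<close> is the projection of
    \<open>w\<close> onto \<open>C\<close>. The inequality for \<open>p\<close> holds at every
    \<open>u i\<close> in \<open>C\<close>, passes to the limit \<open>w\<close>, and forces
    \<open>w = p\<close>.\<close>
  then obtain p where "p \<in> C" and p: "\<And>c. c \<in> C \<Longrightarrow> w \<bullet> (c - p) \<le> p \<bullet> (c - p)"
    using variational_inequality[OF bounded_linear_inner_right[of w] C(2,3)] by (metis empty_iff)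
  have "((\<lambda>i. u i \<bullet> (w - p)) \<longlongrightarrow> w \<bullet> (w - p)) G"
    using lim[of "w - p"] by (simp add: w)
  moreover have "\<forall>\<^sub>F i in G. u i \<bullet> (w - p) \<le> p \<bullet> (w - p)"
    using filter_leD[OF \<open>G \<le> F\<close> u]
  proof eventually_elim
    case (elim i)
    from p[OF elim] show ?case by (simp add: inner_diff_left inner_diff_right inner_commute)
  qed
  ultimately have "w \<bullet> (w - p) \<le> p \<bullet> (w - p)"
    using \<open>G \<noteq> bot\<close> by (intro tendsto_upperbound)
  then have "(w - p) \<bullet> (w - p) \<le> 0" by (simp add: inner_diff_left)
  then have "w - p = 0" by (metis inner_eq_zero_iff inner_ge_zero order_antisym)
  then have "w = p" by simp
  with \<open>p \<in> C\<close> that[OF \<open>G \<noteq> bot\<close> \<open>G \<le> F\<close>, of w] lim w show ?thesis by simp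
qed


section \<open>Fixed point sets of nonexpansive maps\<close>

text \<open>Squaring \<open>norm (w - S y) \<le> norm (w - y)\<close> and splitting
  \<open>w - S y\<close> as \<open>(w - y) + (y - S y)\<close> cancels the term quadratic in
  \<open>w\<close>. Conversely, the choice \<open>y = w\<close> leaves only the squared norm of
  \<open>w - S w\<close>.\<close>

lemma nonexpansive_fixed_iff:
  fixes S :: "'a::real_inner \<Rightarrow> 'a"
  assumes S: "nonexpansive_on C S" and "w \<in> C"
  shows "S w = w \<longleftrightarrow> (\<forall>y\<in>C. 2 * ((w - y) \<bullet> (y - S y)) + (norm (y - S y))\<^sup>2 \<le> 0)"
proof
  assume "S w = w"
  show "\<forall>y\<in>C. 2 * ((w - y) \<bullet> (y - S y)) + (norm (y - S y))\<^sup>2 \<le> 0"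
  proof
    fix y assume "y \<in> C"
    then have "norm (w - S y) \<le> norm (w - y)"
      using S \<open>w \<in> C\<close> \<open>S w = w\<close> unfolding nonexpansive_on_def by metis
    then have "(norm (w - S y))\<^sup>2 \<le> (norm (w - y))\<^sup>2" by simp
    then show "2 * ((w - y) \<bullet> (y - S y)) + (norm (y - S y))\<^sup>2 \<le> 0"
      by (simp add: power2_norm_eq_inner inner_diff_left inner_diff_right inner_commute)
  qed
next
  assume "\<forall>y\<in>C. 2 * ((w - y) \<bullet> (y - S y)) + (norm (y - S y))\<^sup>2 \<le> 0"
  from bspec[OF this \<open>w \<in> C\<close>] show "S w = w" by simp
qed

text \<open>For each \<open>y\<close> the criterion cuts out a closed half-space of points
  \<open>w\<close>, so the fixed point set is \<open>C\<close> intersected with half-spaces.\<close>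

lemma closed_convex_fixed_points:
  fixes S :: "'a::real_inner \<Rightarrow> 'a"
  assumes "nonexpansive_on C S" and "closed C" and "convex C"
  shows "closed {w \<in> C. S w = w}" and "convex {w \<in> C. S w = w}"
proof -
  have "{w \<in> C. S w = w} =
      C \<inter> (\<Inter>y\<in>C. {w. (y - S y) \<bullet> w \<le> (y - S y) \<bullet> y - (norm (y - S y))\<^sup>2 / 2})"
    using nonexpansive_fixed_iff[OF assms(1)]
    by (auto simp: inner_diff_left inner_diff_right inner_commute field_simps)
  then show "closed {w \<in> C. S w = w}" and "convex {w \<in> C. S w = w}"
    using assms(2,3)
    by (auto intro!: closed_Int closed_INT closed_Collect_le continuous_intros
        convex_Int convex_INT convex_halfspace_le)
qed

section \<open>Mean ergodic theorem for orbit means\<close>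

text \<open>Cesaro means of the orbit, starting from \<open>S x\<close> rather than
  \<open>x\<close>. At \<open>n = 0\<close> the value is 0, possibly outside \<open>C\<close>, hence
  the later restrictions to \<open>n \<ge> 1\<close>.\<close>

definition orbit_mean :: "('a::real_vector \<Rightarrow> 'a) \<Rightarrow> 'a \<Rightarrow> nat \<Rightarrow> 'a"
  where "orbit_mean S x n = (1 / real n) *\<^sub>R (\<Sum>k=1..n. (S ^^ k) x)"

lemma funpow_mem:
  assumes "S \<in> C \<rightarrow> C" and "x \<in> C"
  shows "(S ^^ k) x \<in> C"
  using assms by (induction k) auto

lemma inner_orbit_mean:
  "orbit_mean S x n \<bullet> v = (\<Sum>k=1..n. (S ^^ k) x \<bullet> v) / real n"
  by (simp add: orbit_mean_def inner_sum_left)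

lemma orbit_mean_mem:
  assumes "convex C" and "S \<in> C \<rightarrow> C" and "x \<in> C" and "n \<ge> 1"
  shows "orbit_mean S x n \<in> C"
  unfolding orbit_mean_def scaleR_sum_right
  using assms by (intro convex_sum) (auto simp: funpow_mem)

text \<open>The means satisfy the fixed point criterion up to an error: summed along the orbit, the
  one-step estimates telescope to a bound independent of \<open>n\<close>, and division by
  \<open>n\<close> sends it to 0. The criterion is affine in the point, so it survives the weak
  limit.\<close>

lemma orbit_mean_cluster_point_fixed:
  fixes S :: "'a::real_inner \<Rightarrow> 'a"
  assumes S: "nonexpansive_on C S" "S \<in> C \<rightarrow> C" and "x \<in> C" and "w \<in> C"
    and G: "G \<noteq> bot" "G \<le> sequentially"
    and lim: "\<And>v. ((\<lambda>n. orbit_mean S x n \<bullet> v) \<longlongrightarrow> w \<bullet> v) G"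
  shows "S w = w"
  unfolding nonexpansive_fixed_iff[OF S(1) \<open>w \<in> C\<close>]
proof
  fix y assume "y \<in> C"
  define v N where "v = y - S y" and "N = (norm v)\<^sup>2"
  \<comment> \<open>Nonexpansiveness expanded through \<open>S b - S y = (S b - y) + v\<close>; the
    right-hand side telescopes when \<open>b\<close> runs through the orbit.\<close>
  have step: "2 * ((S b - y) \<bullet> v) + N \<le> (norm (b - y))\<^sup>2 - (norm (S b - y))\<^sup>2"
    if "b \<in> C" for b
  proof -
    have "norm (S b - S y) \<le> norm (b - y)"
      using S(1) that \<open>y \<in> C\<close> unfolding nonexpansive_on_def by blast
    then have "(norm (S b - S y))\<^sup>2 \<le> (norm (b - y))\<^sup>2" by simp
    moreover have "(norm (S b - S y))\<^sup>2 = (norm (S b - y))\<^sup>2 + 2 * ((S b - y) \<bullet> v) + N"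
      unfolding v_def N_def
      by (simp add: power2_norm_eq_inner inner_diff_left inner_diff_right inner_commute)
    ultimately show ?thesis by simp
  qed
  have tele: "(\<Sum>k=1..n. 2 * (((S ^^ k) x - y) \<bullet> v) + N)
      \<le> (norm (x - y))\<^sup>2 - (norm ((S ^^ n) x - y))\<^sup>2" for n
  proof (induction n)
    case (Suc n)
    then show ?case using step[OF funpow_mem[OF S(2) \<open>x \<in> C\<close>, of n]] by simp
  qed simp
  have bound: "2 * (orbit_mean S x n \<bullet> v) - 2 * (y \<bullet> v) + N \<le> (norm (x - y))\<^sup>2 / real n"
    if "n \<ge> 1" for n
  proof -
    have "(\<Sum>k=1..n. 2 * (((S ^^ k) x - y) \<bullet> v) + N)
        = real n * (2 * (orbit_mean S x n \<bullet> v) - 2 * (y \<bullet> v) + N)"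
      using that unfolding inner_orbit_mean
      by (simp add: inner_diff_left sum.distrib sum_subtractf sum_distrib_left[symmetric]
          algebra_simps)
    with tele[of n] have "real n * (2 * (orbit_mean S x n \<bullet> v) - 2 * (y \<bullet> v) + N) \<le> (norm (x - y))\<^sup>2"
      using zero_le_power2[of "norm ((S ^^ n) x - y)"] by linarith
    then show ?thesis using that by (simp add: field_simps)
  qed
  have "((\<lambda>n. (norm (x - y))\<^sup>2 / real n) \<longlongrightarrow> 0) G"
    using lim_const_over_n by (rule tendsto_mono[OF G(2)])
  moreover have "((\<lambda>n. 2 * (orbit_mean S x n \<bullet> v) - 2 * (y \<bullet> v) + N)
      \<longlongrightarrow> 2 * (w \<bullet> v) - 2 * (y \<bullet> v) + N) G"
    by (intro tendsto_intros lim)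
  moreover have "\<forall>\<^sub>F n in G. 2 * (orbit_mean S x n \<bullet> v) - 2 * (y \<bullet> v) + N \<le> (norm (x - y))\<^sup>2 / real n"
    using filter_leD[OF G(2) eventually_ge_at_top[of 1]] by eventually_elim (rule bound)
  ultimately have "2 * (w \<bullet> v) - 2 * (y \<bullet> v) + N \<le> 0"
    using G(1) by (intro tendsto_le)
  then show "2 * ((w - y) \<bullet> (y - S y)) + (norm (y - S y))\<^sup>2 \<le> 0"
    unfolding v_def[symmetric] N_def by (simp add: inner_diff_left)
qed

text \<open>Each new term is at most the mean of the earlier ones, so the means decrease as well and
  stay nonnegative.\<close>

lemma convergent_means_decseq:
  fixes d :: "nat \<Rightarrow> real"
  assumes "decseq d" and nonneg: "\<And>n. 0 \<le> d n"
  shows "convergent (\<lambda>n. (\<Sum>k=1..n. d k) / real n)"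
proof -
  \<comment> \<open>The shifted index avoids \<open>n = 0\<close>, where division by zero yields the
    mean 0 and monotonicity could fail.\<close>
  have "decseq (\<lambda>n. (\<Sum>k=1..Suc n. d k) / real (Suc n))"
  proof (rule decseq_SucI)
    fix n
    have "(\<Sum>k=1..Suc n. d (Suc (Suc n))) \<le> (\<Sum>k=1..Suc n. d k)"
      using \<open>decseq d\<close> by (intro sum_mono) (auto simp: decseq_def)
    then have "real (Suc n) * d (Suc (Suc n)) \<le> (\<Sum>k=1..Suc n. d k)" by simp
    moreover have "(\<Sum>k=1..Suc (Suc n). d k) = (\<Sum>k=1..Suc n. d k) + d (Suc (Suc n))" by simp
    moreover have "(s + a) / (m + 1) \<le> s / m" if "m * a \<le> s" "m > 0" for s a m :: real
      using that by (simp add: field_simps)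
    ultimately show "(\<Sum>k=1..Suc (Suc n). d k) / real (Suc (Suc n)) \<le> (\<Sum>k=1..Suc n. d k) / real (Suc n)"
      by (metis of_nat_0_less_iff of_nat_Suc add.commute zero_less_Suc)
  qed
  moreover have "0 \<le> (\<Sum>k=1..Suc n. d k) / real (Suc n)" for n
    using sum_nonneg[of "{1..Suc n}" d] nonneg by simp
  ultimately have "convergent (\<lambda>n. (\<Sum>k=1..Suc n. d k) / real (Suc n))"
    using decseq_convergent[of "\<lambda>n. (\<Sum>k=1..Suc n. d k) / real (Suc n)" 0]
    unfolding convergent_def by blast
  then show ?thesis
    by (subst convergent_Suc_iff[symmetric])
qed

text \<open>Polarisation turns the inner product with \<open>w1 - w2\<close> into half the
  difference of the squared distances to \<open>w2\<close> and \<open>w1\<close>, plus a constant.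
  Both distances decrease along the orbit.\<close>

lemma convergent_orbit_mean_inner:
  fixes S :: "'a::real_inner \<Rightarrow> 'a"
  assumes S: "nonexpansive_on C S" "S \<in> C \<rightarrow> C" and "x \<in> C"
    and w: "w1 \<in> C" "S w1 = w1" "w2 \<in> C" "S w2 = w2"
  shows "convergent (\<lambda>n. orbit_mean S x n \<bullet> (w1 - w2))"
proof -
  define d where "d w k = (norm ((S ^^ k) x - w))\<^sup>2" for w k
  have conv: "convergent (\<lambda>n. (\<Sum>k=1..n. d w k) / real n)" if "w \<in> C" "S w = w" for w
  proof (rule convergent_means_decseq)
    show "decseq (d w)"
    proof (rule decseq_SucI)
      fix k
      have "norm (S ((S ^^ k) x) - S w) \<le> norm ((S ^^ k) x - w)"
        using S(1) funpow_mem[OF S(2) \<open>x \<in> C\<close>] \<open>w \<in> C\<close> unfolding nonexpansive_on_def by blast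
      then show "d w (Suc k) \<le> d w k" using that(2) by (simp add: d_def)
    qed
  qed (simp add: d_def)
  define c where "c = ((norm w1)\<^sup>2 - (norm w2)\<^sup>2) / 2"
  have eq: "(S ^^ k) x \<bullet> (w1 - w2) = d w2 k / 2 - d w1 k / 2 + c" for k
    unfolding c_def d_def
    by (simp add: power2_norm_eq_inner inner_diff_left inner_diff_right inner_commute field_simps)
  have "orbit_mean S x n \<bullet> (w1 - w2) =
      (1/2) * ((\<Sum>k=1..n. d w2 k) / real n - (\<Sum>k=1..n. d w1 k) / real n) + c" if "n \<ge> 1" for n
    using that unfolding inner_orbit_mean eq
    by (simp add: sum.distrib sum_subtractf sum_divide_distrib[symmetric] field_simps)
  then have "\<forall>\<^sub>F n in sequentially. orbit_mean S x n \<bullet> (w1 - w2) =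
      (1/2) * ((\<Sum>k=1..n. d w2 k) / real n - (\<Sum>k=1..n. d w1 k) / real n) + c"
    by (rule eventually_mono[OF eventually_ge_at_top[of 1]])
  moreover have "convergent (\<lambda>n.
      (1/2) * ((\<Sum>k=1..n. d w2 k) / real n - (\<Sum>k=1..n. d w1 k) / real n) + c)"
    using conv w by (intro convergent_add convergent_mult convergent_diff convergent_const) auto
  ultimately show ?thesis
    by (simp only: convergent_cong)
qed

text \<open>The means paired with \<open>w1 - w2\<close> have a single limit, which each filter
  evaluates at its own cluster point; subtracting leaves the squared norm of
  \<open>w1 - w2\<close>.\<close>

lemma orbit_mean_cluster_point_unique:
  fixes S :: "'a::real_inner \<Rightarrow> 'a"
  assumes S: "nonexpansive_on C S" "S \<in> C \<rightarrow> C" and "x \<in> C"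
    and w: "w1 \<in> C" "w2 \<in> C"
    and G1: "G1 \<noteq> bot" "G1 \<le> sequentially"
      "\<And>v. ((\<lambda>n. orbit_mean S x n \<bullet> v) \<longlongrightarrow> w1 \<bullet> v) G1"
    and G2: "G2 \<noteq> bot" "G2 \<le> sequentially"
      "\<And>v. ((\<lambda>n. orbit_mean S x n \<bullet> v) \<longlongrightarrow> w2 \<bullet> v) G2"
  shows "w1 = w2"
proof -
  have "S w1 = w1" "S w2 = w2"
    using orbit_mean_cluster_point_fixed[OF S \<open>x \<in> C\<close>] w G1 G2 by blast+
  then obtain l where l: "(\<lambda>n. orbit_mean S x n \<bullet> (w1 - w2)) \<longlonglongrightarrow> l"
    using convergent_orbit_mean_inner[OF S \<open>x \<in> C\<close>] w by (meson convergent_def)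
  have "l = w1 \<bullet> (w1 - w2)"
    using tendsto_unique[OF G1(1)] tendsto_mono[OF G1(2) l] G1(3) by blast
  moreover have "l = w2 \<bullet> (w1 - w2)"
    using tendsto_unique[OF G2(1)] tendsto_mono[OF G2(2) l] G2(3) by blast
  ultimately have "(w1 - w2) \<bullet> (w1 - w2) = 0" by (simp add: inner_diff_left)
  then show ?thesis by simp
qed

text \<open>Baillon's theorem; it also serves below as the existence theorem for fixed
  points.\<close>

theorem nonexpansive_mean_ergodic:
  fixes S :: "'a::{real_inner, complete_space} \<Rightarrow> 'a"
  assumes S: "nonexpansive_on C S" "S \<in> C \<rightarrow> C"
    and C: "bounded C" "closed C" "convex C" and "x \<in> C"
  obtains z where "z \<in> C" and "S z = z" and "weakly_converges (orbit_mean S x) z"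
proof -
  have mem: "\<forall>\<^sub>F n in sequentially. orbit_mean S x n \<in> C"
    using eventually_ge_at_top[of 1] by eventually_elim (rule orbit_mean_mem[OF C(3) S(2) \<open>x \<in> C\<close>])
  obtain G z where G: "G \<noteq> bot" "G \<le> sequentially"
      "\<And>v. ((\<lambda>n. orbit_mean S x n \<bullet> v) \<longlongrightarrow> z \<bullet> v) G" and "z \<in> C"
    using weak_cluster_point[OF _ C mem] by (metis sequentially_bot)
  have "S z = z"
    using orbit_mean_cluster_point_fixed[OF S \<open>x \<in> C\<close> \<open>z \<in> C\<close>] G by blast
  moreover have "weakly_converges (orbit_mean S x) z"
    unfolding weakly_converges_def
  proof (intro allI impI)
    fix f :: "'a \<Rightarrow> real" assume "bounded_linear f"
    then obtain p where f: "f = (\<lambda>y. y \<bullet> p)"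
      by (metis Riesz_representation inner_commute)
    show "(\<lambda>n. f (orbit_mean S x n)) \<longlonglongrightarrow> f z"
    proof (rule tendstoI, rule ccontr)
      fix e :: real assume "e > 0"
      \<comment> \<open>The tails of the indices with error at least \<open>e\<close>. Weak
        compactness along them yields a cluster point, which uniqueness identifies with
        \<open>z\<close>, contradicting the error bound.\<close>
      define F where "F = inf sequentially (principal {n. \<not> dist (f (orbit_mean S x n)) (f z) < e})"
      assume "\<not> (\<forall>\<^sub>F n in sequentially. dist (f (orbit_mean S x n)) (f z) < e)"
      then have "F \<noteq> bot"
        by (simp add: F_def trivial_limit_def eventually_inf_principal)
      moreover have "F \<le> sequentially" by (simp add: F_def)
      ultimately obtain H w where H: "H \<noteq> bot" "H \<le> F" "w \<in> C"
          "\<And>v. ((\<lambda>n. orbit_mean S x n \<bullet> v) \<longlongrightarrow> w \<bullet> v) H"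
        using weak_cluster_point[OF _ C filter_leD[OF _ mem]] by metis
      then have "w = z"
        using orbit_mean_cluster_point_unique[OF S \<open>x \<in> C\<close> \<open>w \<in> C\<close> \<open>z \<in> C\<close>] G \<open>F \<le> sequentially\<close>
        by (meson order_trans)
      then have "\<forall>\<^sub>F n in H. dist (f (orbit_mean S x n)) (f z) < e"
        using tendstoD[OF H(4) \<open>e > 0\<close>] by (simp add: f)
      moreover have "\<forall>\<^sub>F n in F. \<not> dist (f (orbit_mean S x n)) (f z) < e"
        by (simp add: F_def eventually_inf_principal)
      then have "\<forall>\<^sub>F n in H. \<not> dist (f (orbit_mean S x n)) (f z) < e"
        using H(2) filter_leD by blast
      ultimately have "\<forall>\<^sub>F n in H. False" by eventually_elim blast
      then show False using H(1) by simp
    qed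
  qed
  ultimately show ?thesis using that \<open>z \<in> C\<close> by blast
qed

section \<open>Common fixed points of two maps\<close>

text \<open>By commutation \<open>B\<close> maps the fixed point set of \<open>A\<close> into
  itself. That set is nonempty, bounded, closed and convex, so the ergodic theorem applies again
  with it in place of \<open>C\<close>.\<close>

lemma commuting_nonexpansive_common_fixed_point:
  fixes A B :: "'a::{real_inner, complete_space} \<Rightarrow> 'a"
  assumes C: "bounded C" "closed C" "convex C" "C \<noteq> {}"
    and A: "nonexpansive_on C A" "A \<in> C \<rightarrow> C"
    and B: "nonexpansive_on C B" "B \<in> C \<rightarrow> C"
    and comm: "\<And>y. y \<in> C \<Longrightarrow> A (B y) = B (A y)"
  obtains p where "p \<in> C" and "A p = p" and "B p = p"
proof -
  define K where "K = {w \<in> C. A w = w}"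
  obtain y where "y \<in> K"
    using C nonexpansive_mean_ergodic[OF A C(1-3)] unfolding K_def by blast
  have "closed K" "convex K"
    unfolding K_def using closed_convex_fixed_points[OF A(1) C(2,3)] .
  moreover have "bounded K"
    using C(1) by (rule bounded_subset) (auto simp: K_def)
  moreover have "nonexpansive_on K B" "B \<in> K \<rightarrow> K"
    using B comm by (auto simp: K_def nonexpansive_on_def)
  ultimately obtain p where "p \<in> K" "B p = p"
    using nonexpansive_mean_ergodic[of K B y] \<open>y \<in> K\<close> by blast
  then show ?thesis using that unfolding K_def by blast
qed

text \<open>The vectors \<open>z - A z\<close> and \<open>z - B z\<close> are opposite, so adding
  the two criteria for \<open>p\<close>, tested at \<open>z\<close>, cancels the inner products and
  leaves a sum of squares.\<close>

lemma fixed_point_of_average: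
  fixes A B :: "'a::real_inner \<Rightarrow> 'a"
  assumes A: "nonexpansive_on C A" and B: "nonexpansive_on C B"
    and p: "p \<in> C" "A p = p" "B p = p"
    and z: "z \<in> C" "(1 / 2) *\<^sub>R (A z + B z) = z"
  shows "A z = z" and "B z = z"
proof -
  have "2 * ((p - z) \<bullet> (z - A z)) + (norm (z - A z))\<^sup>2 \<le> 0"
    using nonexpansive_fixed_iff[OF A p(1)] p(2) z(1) by blast
  moreover have "2 * ((p - z) \<bullet> (z - B z)) + (norm (z - B z))\<^sup>2 \<le> 0"
    using nonexpansive_fixed_iff[OF B p(1)] p(3) z(1) by blast
  moreover have "z - B z = - (z - A z)"
  proof -
    have "A z + B z = 2 *\<^sub>R z" using arg_cong[OF z(2), of "\<lambda>u. 2 *\<^sub>R u"] by simp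
    then show ?thesis by (simp add: scaleR_2 algebra_simps)
  qed
  ultimately have "(norm (z - A z))\<^sup>2 \<le> 0" and "norm (z - B z) = norm (z - A z)"
    by (simp_all only: inner_minus_right norm_minus_cancel)
  then show "A z = z" and "B z = z" by simp_all
qed

section \<open>Dense times and fixed points of the semigroup\<close>

lemma small_integer_combination:
  fixes \<alpha> \<beta> e :: real
  assumes pos: "\<alpha> > 0" "\<beta> > 0" and irr: "\<alpha> / \<beta> \<notin> \<rat>" and "e > 0"
  obtains k h :: nat where "0 < \<bar>real k * \<alpha> - real h * \<beta>\<bar>" and "\<bar>real k * \<alpha> - real h * \<beta>\<bar> < e"
proof -
  \<comment> \<open>Dirichlet's error \<open>1 / N\<close> is later multiplied by \<beta>, and
    \<open>\<beta> / N < e\<close> is the bound required.\<close>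
  obtain N :: nat where "N > 0" and N: "\<beta> / e < real N"
    using reals_Archimedean2[of "\<beta> / e"] pos \<open>e > 0\<close> by (metis divide_pos_pos less_trans of_nat_0_less_iff)
  obtain h k where k: "0 < k" "k \<le> int N" and hk: "\<bar>of_int k * (\<alpha> / \<beta>) - of_int h\<bar> < 1 / real N"
    using Dirichlet_approx[OF \<open>N > 0\<close>] by blast
  \<comment> \<open>An error below 1 around a positive number puts the integer \<open>h\<close>
    above -1, so \<open>h\<close> can be read as a natural number.\<close>
  have "0 < of_int k * (\<alpha> / \<beta>)" using k pos by simp
  moreover have "1 / real N \<le> 1" using \<open>N > 0\<close> by simp
  ultimately have "h \<ge> 0" using hk by linarith
  have eq: "\<bar>of_int k * \<alpha> - of_int h * \<beta>\<bar> = \<beta> * \<bar>of_int k * (\<alpha> / \<beta>) - of_int h\<bar>"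
    using pos by (simp add: abs_mult_pos' right_diff_distrib mult.commute)
  also have "\<dots> < \<beta> * (1 / real N)" using hk pos by (intro mult_strict_left_mono)
  also have "\<dots> < e" using N \<open>N > 0\<close> \<open>e > 0\<close> by (simp add: field_simps)
  finally have "\<bar>of_int k * \<alpha> - of_int h * \<beta>\<bar> < e" .
  moreover have "of_int k * \<alpha> - of_int h * \<beta> \<noteq> 0"
  proof
    assume "of_int k * \<alpha> - of_int h * \<beta> = 0"
    then have "\<alpha> / \<beta> = of_int h / of_int k" using k pos by (simp add: field_simps)
    then show False using irr by (metis Rats_divide Rats_of_int)
  qed
  ultimately show ?thesis
    using that[of "nat k" "nat h"] k \<open>h \<ge> 0\<close> by simp
qed

lemma nonexpansive_semigroup_fixed_point:
  assumes "Hausdorff_space \<tau>" and sg: "nonexpansive_semigroup \<tau> C T"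
    and pos: "\<alpha> > 0" "\<beta> > 0" and irr: "\<alpha> / \<beta> \<notin> \<rat>"
    and "z \<in> C" and \<alpha>: "T \<alpha> z = z" and \<beta>: "T \<beta> z = z"
  shows "common_fixed_point C T z"
proof -
  define P where "P = {t \<in> {0..}. T t z = z}"
  have semi: "T (s + t) z = T s (T t z)" if "s \<ge> 0" "t \<ge> 0" for s t
    using sg that \<open>z \<in> C\<close> unfolding nonexpansive_semigroup_def by blast
  have add: "s + t \<in> P" if "s \<in> P" "t \<in> P" for s t
    using that semi[of s t] by (auto simp: P_def)
  \<comment> \<open>The larger time is the smaller one followed by the difference, and the smaller
    one already fixes \<open>z\<close>; the two instances cover both orders.\<close>
  have diff: "\<bar>t - s\<bar> \<in> P" if "s \<in> P" "t \<in> P" for s t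
    using that semi[of "t - s" s] semi[of "s - t" t] by (auto simp: P_def abs_if)
  have mult: "real n * t \<in> P" if "t \<in> P" for n t
  proof (induction n)
    \<comment> \<open>\<open>T 0\<close> need not be the identity, so \<open>0 \<in> P\<close> is
      obtained as the difference of \<open>t\<close> with itself.\<close>
    case 0
    show ?case using diff[OF that that] by simp
  next
    case (Suc n)
    show ?case using add[OF that Suc] by (simp add: algebra_simps)
  qed
  \<comment> \<open>The set is the equaliser of the orbit map of \<open>z\<close> and the constant
    map \<open>z\<close>, both continuous into a Hausdorff space.\<close>
  have "closedin (top_of_set {0..}) {t \<in> topspace (top_of_set {0::real..}). T t z = z}"
  proof (rule closedin_continuous_maps_eq[OF \<open>Hausdorff_space \<tau>\<close>])
    have "continuous_map (top_of_set {0..}) (subtopology \<tau> C) (\<lambda>t. T t z)"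
      using sg \<open>z \<in> C\<close> unfolding nonexpansive_semigroup_def by blast
    then show cont: "continuous_map (top_of_set {0..}) \<tau> (\<lambda>t. T t z)"
      by (simp add: continuous_map_in_subtopology)
    have "z \<in> topspace \<tau>"
      using continuous_map_image_subset_topspace[OF cont] \<alpha> pos image_eqI[of z "\<lambda>t. T t z" \<alpha> "{0..}"]
      by auto
    then show "continuous_map (top_of_set {0..}) \<tau> (\<lambda>t. z)" by simp
  qed
  then have "closed P"
    by (simp add: P_def closedin_closed_eq)
  have "\<alpha> \<in> P" "\<beta> \<in> P" using pos \<alpha> \<beta> by (auto simp: P_def)
  have "t \<in> P" if "t \<ge> 0" for t
  proof -
    have "\<exists>s\<in>P. dist s t < e" if "e > 0" for e
    proof -
      obtain k h :: nat where kh: "0 < \<bar>real k * \<alpha> - real h * \<beta>\<bar>" "\<bar>real k * \<alpha> - real h * \<beta>\<bar> < e"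
        using small_integer_combination[OF pos irr \<open>e > 0\<close>] .
      \<comment> \<open>A positive element of \<open>P\<close> below \<open>e\<close>; its largest
        multiple not exceeding \<open>t\<close> lies in \<open>P\<close> within \<open>e\<close> of
        \<open>t\<close>.\<close>
      define d where "d = \<bar>real k * \<alpha> - real h * \<beta>\<bar>"
      have "d \<in> P" unfolding d_def by (intro diff mult \<open>\<alpha> \<in> P\<close> \<open>\<beta> \<in> P\<close>)
      have d: "0 < d" "d < e" using kh by (auto simp: d_def)
      define n where "n = nat \<lfloor>t / d\<rfloor>"
      have "real n = of_int \<lfloor>t / d\<rfloor>" using \<open>t \<ge> 0\<close> d by (simp add: n_def)
      then have "real n \<le> t / d" "t / d < real n + 1" by linarith+
      then have "real n * d \<le> t" "t < real n * d + d"
        using d by (simp_all add: field_simps)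
      then have "dist (real n * d) t < e" using d by (simp add: dist_real_def)
      then show ?thesis using mult[OF \<open>d \<in> P\<close>] by blast
    qed
    then have "t \<in> closure P" unfolding closure_approachable by blast
    then show ?thesis using \<open>closed P\<close> by simp
  qed
  then show ?thesis using \<open>z \<in> C\<close> by (auto simp: common_fixed_point_def P_def)
qed

section \<open>Weak convergence for the average of two semigroup maps\<close>

theorem theorem6:
  fixes \<tau> :: "'a::{real_inner, complete_space} topology"
    and C :: "'a set"
    and T :: "real \<Rightarrow> 'a \<Rightarrow> 'a"
    and \<alpha> \<beta> :: real
    and x :: 'a
    and xs :: "nat \<Rightarrow> 'a"
  assumes "topspace \<tau> = UNIV" and "Hausdorff_space \<tau>"
    and "bounded C" and "closed C" and "convex C"
    and "nonexpansive_semigroup \<tau> C T"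
    and "\<alpha> > 0" and "\<beta> > 0" and "\<alpha> / \<beta> \<notin> \<rat>"
    and "x \<in> C"
    and "\<And>n. n \<ge> 1 \<Longrightarrow> xs n = (1 / real n) *\<^sub>R
           (\<Sum>k=1..n. ((\<lambda>y. (1 / 2) *\<^sub>R (T \<alpha> y + T \<beta> y)) ^^ k) x)"
  shows "\<exists>z. common_fixed_point C T z \<and> weakly_converges xs z"
proof -
  note C = assms(3-5) and sg = assms(6) and pos = assms(7,8)
  define S where "S = (\<lambda>y. (1 / 2) *\<^sub>R (T \<alpha> y + T \<beta> y))"
  have A: "nonexpansive_on C (T \<alpha>)" "T \<alpha> \<in> C \<rightarrow> C"
    and B: "nonexpansive_on C (T \<beta>)" "T \<beta> \<in> C \<rightarrow> C"
    using sg pos unfolding nonexpansive_semigroup_def by auto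
  \<comment> \<open>Both sides equal \<open>T (\<alpha> + \<beta>) y\<close>.\<close>
  have comm: "T \<alpha> (T \<beta> y) = T \<beta> (T \<alpha> y)" if "y \<in> C" for y
    using sg pos that unfolding nonexpansive_semigroup_def
    by (metis add.commute less_eq_real_def)
  obtain p where p: "p \<in> C" "T \<alpha> p = p" "T \<beta> p = p"
    using commuting_nonexpansive_common_fixed_point[OF C _ A B comm] \<open>x \<in> C\<close> by blast
  have "S y \<in> C" if "y \<in> C" for y
    using convexD[OF \<open>convex C\<close>, of "T \<alpha> y" "T \<beta> y" "1/2" "1/2"] A B that
    by (auto simp: S_def scaleR_add_right)
  then have "S \<in> C \<rightarrow> C" by blast
  moreover have "nonexpansive_on C S"
    unfolding nonexpansive_on_def
  proof (intro ballI)
    fix u v assume uv: "u \<in> C" "v \<in> C"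
    have "S u - S v = (1 / 2) *\<^sub>R ((T \<alpha> u - T \<alpha> v) + (T \<beta> u - T \<beta> v))"
      by (simp add: S_def algebra_simps)
    then have "norm (S u - S v) \<le> (norm (T \<alpha> u - T \<alpha> v) + norm (T \<beta> u - T \<beta> v)) / 2"
      using norm_triangle_ineq[of "T \<alpha> u - T \<alpha> v" "T \<beta> u - T \<beta> v"] by simp
    also have "\<dots> \<le> (norm (u - v) + norm (u - v)) / 2"
      using A(1) B(1) uv unfolding nonexpansive_on_def by (intro divide_right_mono add_mono) auto
    finally show "norm (S u - S v) \<le> norm (u - v)" by simp
  qed
  ultimately obtain z where z: "z \<in> C" "S z = z" "weakly_converges (orbit_mean S x) z"
    using nonexpansive_mean_ergodic[OF _ _ C \<open>x \<in> C\<close>] by metis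
  then have "T \<alpha> z = z" "T \<beta> z = z"
    using fixed_point_of_average[OF A(1) B(1) p] by (simp_all add: S_def)
  then have "common_fixed_point C T z"
    using nonexpansive_semigroup_fixed_point[OF assms(2) sg pos assms(9) z(1)] by blast
  \<comment> \<open>\<open>xs 0\<close> is unconstrained, so the two sequences are compared only
    from \<open>n = 1\<close> on.\<close>
  moreover have "\<forall>\<^sub>F n in sequentially. orbit_mean S x n = xs n"
    using eventually_ge_at_top[of 1]
    by eventually_elim (simp add: assms(11) orbit_mean_def S_def)
  then have "\<forall>\<^sub>F n in sequentially. f (orbit_mean S x n) = f (xs n)" for f :: "'a \<Rightarrow> real"
    by eventually_elim simp
  then have "weakly_converges xs z"
    using z(3) unfolding weakly_converges_def by (metis Lim_transform_eventually)
  ultimately show ?thesis by blast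
qed

end
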